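(* Let $\Omega\subseteq\mathbb{R}^n$ be open and let $u\in C^1(\Omega)$ be a real-valued function such that $|Du|$ has no local minima in $\Omega$. For each nonempty open $\Omega'\Subset\Omega$ put $$\Omega'(u):=\Big\{x\in\overline{\Omega'}\ :\ |Du(x)|=\|Du\|_{L^\infty(\Omega')}\Big\}$$ and let $\mathcal{A}^{\pm,\infty}_{\Omega'}(u)$ be the set consisting of all constant functions $\mathbb{R}^n\to\mathbb{R}$ together with all affine functions $A:\mathbb{R}^n\to\mathbb{R}$ for which there exist $\xi\in\mathbb{R}^{\pm}$, $x\in\Omega'(u)$ and $\mathbf{X}_x\in D^{2,\pm}u(x)$ such that $DA\equiv\xi\,\mathbf{X}_x\,Du(x)$. Then the following two equivalences hold. (i) $Du\otimes Du:D^2u\geq 0$ on $\Omega$ in the viscosity sense if and only if for all nonempty open $\Omega'\Subset\Omega$ and all $A\in\mathcal{A}^{+,\infty}_{\Omega'}(u)$, $$\|Du\|_{L^\infty(\Omega')}\leq\|Du+DA\|_{L^\infty(\Omega')}.$$ (ii) $Du\otimes Du:D^2u\leq 0$ on $\Omega$ in the viscosity sense if and only if for all nonempty open $\Omega'\Subset\Omega$ and all $A\in\mathcal{A}^{-,\infty}_{\Omega'}(u)$, $$\|Du\|_{L^\infty(\Omega')}\leq\|Du+DA\|_{L^\infty(\Omega')}.$$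
   Context: $\mathbb{R}^+=[0,\infty)$, $\mathbb{R}^-=(-\infty,0]$; $\mathbb{R}^{n^2}_s$ is the space of symmetric $n\times n$ real matrices; $|\cdot|$ is the Euclidean norm; $P\otimes P:\mathbf{X}=\sum_{i,j}P_iP_j\mathbf{X}_{ij}$; $\Omega'\Subset\Omega$ means that $\overline{\Omega'}$ is compact and contained in $\Omega$; $\|Du\|_{L^\infty(\Omega')}=\operatorname{ess\,sup}_{\Omega'}|Du|$. For continuous $u:\Omega\to\mathbb{R}$ and $x\in\Omega$, the second order superjet-type set $J^{2,+}u(x)$ (resp. $J^{2,-}u(x)$) is the set of all $(P,\mathbf{X})\in\mathbb{R}^n\times\mathbb{R}^{n^2}_s$ such that $$u(z+x)\le\ (\text{resp. }\ge)\ \ u(x)+P\cdot z+\tfrac12\mathbf{X}:z\otimes z+o(|z|^2)\quad\text{as }z\to0.$$ $J_0^{2,\pm}u(x)$ denotes the subset of those $(P,\mathbf{X})\in J^{2,\pm}u(x)$ with $P\neq0$. If $u\in C^1(\Omega)$ then every such $P$ equals $Du(x)$, and $$D^{2,\pm}u(x):=\{\mathbf{X}\in\mathbb{R}^{n^2}_s:\ (Du(x),\mathbf{X})\in J_0^{2,\pm}u(x)\}.$$ $u$ satisfies $Du\otimes Du:D^2u\ge0$ (resp. $\le0$) on $\Omega$ in the viscosity sense when, for every $x\in\Omega$, $P\otimes P:\mathbf{X}\ge0$ for all $(P,\mathbf{X})\in J^{2,+}u(x)$ (resp. $P\otimes P:\mathbf{X}\le0$ for all $(P,\mathbf{X})\in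 J^{2,-}u(x)$). *)

theory Defs
  imports
    "HOL-Analysis.Analysis"
    "HOL-Library.Landau_Symbols"
    "HOL-Probability.Essential_Supremum"
begin

text \<open>
  A function on an open set \<open>\<Omega>\<close> is a total function of which only the values on \<open>\<Omega>\<close> matter:
  \<open>grad\<close>, the jets and the local minima below depend on nothing else at points of \<open>\<Omega>\<close>.
\<close>

definition grad :: "(real^'n \<Rightarrow> real) \<Rightarrow> real^'n \<Rightarrow> real^'n" where
  "grad u x = (THE D. GDERIV u x :> D)"

definition C1_on :: "(real^'n) set \<Rightarrow> (real^'n \<Rightarrow> real) \<Rightarrow> bool" where
  "C1_on \<Omega> u \<longleftrightarrow> (\<forall>x\<in>\<Omega>. u differentiable (at x)) \<and> continuous_on \<Omega> (grad u)"

definition local_min_on :: "(real^'n \<Rightarrow> real) \<Rightarrow> (real^'n) set \<Rightarrow> real^'n \<Rightarrow> bool" where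
  "local_min_on f S x \<longleftrightarrow> x \<in> S \<and> (\<forall>\<^sub>F y in at x within S. f x \<le> f y)"

text \<open>
  The contraction \<open>A : B\<close>, i.e. the sum of all \<open>A\<^sub>i\<^sub>j B\<^sub>i\<^sub>j\<close>, is the library's
  inner product \<open>A \<bullet> B\<close> on \<^typ>\<open>real^'n^'n\<close>.
\<close>

definition tensor :: "real^'n \<Rightarrow> real^'n \<Rightarrow> real^'n^'n" where
  "tensor p q = (\<chi> i j. p $ i * q $ j)"

definition superjet :: "(real^'n \<Rightarrow> real) \<Rightarrow> real^'n \<Rightarrow> ((real^'n) \<times> (real^'n^'n)) set" where
  "superjet u x = {(P, X). transpose X = X \<and>
     (\<exists>r \<in> o[at 0](\<lambda>z. (norm z)\<^sup>2).
        \<forall>\<^sub>F z in at 0. u (z + x) \<le> u x + P \<bullet> z + 1/2 * (X \<bullet> tensor z z) + r z)}"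

definition subjet :: "(real^'n \<Rightarrow> real) \<Rightarrow> real^'n \<Rightarrow> ((real^'n) \<times> (real^'n^'n)) set" where
  "subjet u x = {(P, X). transpose X = X \<and>
     (\<exists>r \<in> o[at 0](\<lambda>z. (norm z)\<^sup>2).
        \<forall>\<^sub>F z in at 0. u (z + x) \<ge> u x + P \<bullet> z + 1/2 * (X \<bullet> tensor z z) + r z)}"

definition superjet0 :: "(real^'n \<Rightarrow> real) \<Rightarrow> real^'n \<Rightarrow> ((real^'n) \<times> (real^'n^'n)) set" where
  "superjet0 u x = {(P, X) \<in> superjet u x. P \<noteq> 0}"

definition subjet0 :: "(real^'n \<Rightarrow> real) \<Rightarrow> real^'n \<Rightarrow> ((real^'n) \<times> (real^'n^'n)) set" where
  "subjet0 u x = {(P, X) \<in> subjet u x. P \<noteq> 0}"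

definition D2_plus :: "(real^'n \<Rightarrow> real) \<Rightarrow> real^'n \<Rightarrow> (real^'n^'n) set" where
  "D2_plus u x = {X. (grad u x, X) \<in> superjet0 u x}"

definition D2_minus :: "(real^'n \<Rightarrow> real) \<Rightarrow> real^'n \<Rightarrow> (real^'n^'n) set" where
  "D2_minus u x = {X. (grad u x, X) \<in> subjet0 u x}"

definition viscosity_ge0 :: "(real^'n) set \<Rightarrow> (real^'n \<Rightarrow> real) \<Rightarrow> bool" where
  "viscosity_ge0 \<Omega> u \<longleftrightarrow> (\<forall>x\<in>\<Omega>. \<forall>(P, X)\<in>superjet u x. tensor P P \<bullet> X \<ge> 0)"

definition viscosity_le0 :: "(real^'n) set \<Rightarrow> (real^'n \<Rightarrow> real) \<Rightarrow> bool" where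
  "viscosity_le0 \<Omega> u \<longleftrightarrow> (\<forall>x\<in>\<Omega>. \<forall>(P, X)\<in>subjet u x. tensor P P \<bullet> X \<le> 0)"

definition compactly_contained :: "(real^'n) set \<Rightarrow> (real^'n) set \<Rightarrow> bool" (infix "\<Subset>" 50) where
  "\<Omega>' \<Subset> \<Omega> \<longleftrightarrow> compact (closure \<Omega>') \<and> closure \<Omega>' \<subseteq> \<Omega>"

definition Linf_norm :: "(real^'n) set \<Rightarrow> (real^'n \<Rightarrow> real^'n) \<Rightarrow> ennreal" where
  "Linf_norm S F = esssup (lebesgue_on S) (\<lambda>x. ennreal (norm (F x)))"

definition max_points :: "(real^'n) set \<Rightarrow> (real^'n \<Rightarrow> real) \<Rightarrow> (real^'n) set" where
  "max_points \<Omega>' u =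
     {x \<in> closure \<Omega>'. ennreal (norm (grad u x)) = Linf_norm \<Omega>' (grad u)}"

definition affine_fun :: "(real^'n \<Rightarrow> real) \<Rightarrow> bool" where
  "affine_fun A \<longleftrightarrow> (\<exists>a b. A = (\<lambda>y. a \<bullet> y + b))"

definition affine_plus :: "(real^'n) set \<Rightarrow> (real^'n \<Rightarrow> real) \<Rightarrow> (real^'n \<Rightarrow> real) set" where
  "affine_plus \<Omega>' u =
     {A. \<exists>c. A = (\<lambda>y. c)} \<union>
     {A. affine_fun A \<and>
        (\<exists>\<xi>\<ge>0. \<exists>x\<in>max_points \<Omega>' u. \<exists>X\<in>D2_plus u x. \<forall>y. grad A y = \<xi> *\<^sub>R (X *v grad u x))}"

definition affine_minus :: "(real^'n) set \<Rightarrow> (real^'n \<Rightarrow> real) \<Rightarrow> (real^'n \<Rightarrow> real) set" where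
  "affine_minus \<Omega>' u =
     {A. \<exists>c. A = (\<lambda>y. c)} \<union>
     {A. affine_fun A \<and>
        (\<exists>\<xi>\<le>0. \<exists>x\<in>max_points \<Omega>' u. \<exists>X\<in>D2_minus u x. \<forall>y. grad A y = \<xi> *\<^sub>R (X *v grad u x))}"

end

theory Submission
  imports Defs
begin

text \<open>
  At a point \<open>x\<close> of \<open>max_points \<Omega>' u\<close> with \<open>P = Du(x)\<close>, expanding \<open>\<bar>P + \<xi> X P\<bar>\<^sup>2\<close> shows that
  \<open>\<bar>P\<bar> \<le> \<bar>P + \<xi> X P\<bar>\<close> as soon as \<open>\<xi> P \<bullet> X P \<ge> 0\<close>, and \<open>Du\<close> is continuous up to the closure of
  \<open>\<Omega>'\<close>, which gives the direct implications. Conversely, since \<open>\<bar>Du\<bar>\<close> has no local minimum, every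
  \<open>x\<close> in \<open>\<Omega>\<close> is a maximum point of \<open>\<bar>Du\<bar>\<close> over the closure of the open set of all \<open>y\<close> near \<open>x\<close> with
  \<open>\<bar>Du(y)\<bar> < \<bar>Du(x)\<bar>\<close>. Shrinking this set to \<open>x\<close> turns the minimality into
  \<open>\<bar>P\<bar> \<le> \<bar>P + \<xi> X P\<bar>\<close> for all admissible \<open>\<xi>\<close>, whence the sign of \<open>P \<bullet> X P\<close>.
\<close>

section \<open>Gradients and jets\<close>

lemma GDERIV_unique:
  fixes u :: "real^'n \<Rightarrow> real"
  assumes "GDERIV u x :> D" "GDERIV u x :> E"
  shows "D = E"
proof -
  have "(\<lambda>h. h \<bullet> D) = (\<lambda>h. h \<bullet> E)"
    using assms unfolding gderiv_def by (rule has_derivative_unique)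
  then show ?thesis
    by (metis vector_eq_ldot)
qed

lemma grad_eqI:
  assumes "GDERIV u x :> D"
  shows "grad u x = D"
  unfolding grad_def using assms GDERIV_unique by blast

lemma GDERIV_grad:
  fixes u :: "real^'n \<Rightarrow> real"
  assumes "u differentiable (at x)"
  shows "GDERIV u x :> grad u x"
proof -
  obtain f where f: "(u has_derivative f) (at x)"
    using assms by (auto simp: differentiable_def)
  then have "linear f"
    by (rule has_derivative_linear)
  \<comment> \<open>The vector \<open>adjoint f 1\<close> is the Riesz representative of the
    functional \<open>f\<close>.\<close>
  then have "f = (\<lambda>h. h \<bullet> adjoint f 1)"
    using adjoint_works[of f] by (auto simp: fun_eq_iff)
  with f have "GDERIV u x :> adjoint f 1"
    by (simp add: gderiv_def)
  then show ?thesis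
    using grad_eqI by metis
qed

lemma GDERIV_remainder:
  fixes u :: "real^'n \<Rightarrow> real"
  assumes "GDERIV u x :> D"
  shows "(\<lambda>z. u (z + x) - u x - D \<bullet> z) \<in> o[at 0](norm)"
proof (rule landau_o.smallI)
  fix c :: real assume "c > 0"
  then obtain d where d: "d > 0"
    "\<And>y. norm (y - x) < d \<Longrightarrow> norm (u y - u x - (y - x) \<bullet> D) \<le> c * norm (y - x)"
    using assms unfolding gderiv_def has_derivative_at_alt by blast
  have "norm (u (z + x) - u x - D \<bullet> z) \<le> c * norm (norm z)" if "norm z < d" for z
    using d(2)[of "z + x"] that by (simp add: inner_commute)
  then show "\<forall>\<^sub>F z in at 0. norm (u (z + x) - u x - D \<bullet> z) \<le> c * norm (norm z)"
    using d(1) by (auto simp: eventually_at dist_norm)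
qed

lemma grad_affine: "grad (\<lambda>y. a \<bullet> y + b) x = a"
proof (rule grad_eqI)
  show "GDERIV (\<lambda>y. a \<bullet> y + b) x :> a"
    unfolding gderiv_def by (auto intro!: derivative_eq_intros simp: inner_commute)
qed

lemma grad_const: "grad (\<lambda>y. c) x = 0"
  using grad_affine[of 0 c x] by simp

section \<open>The first-order part of a jet\<close>

lemma inner_tensor: "X \<bullet> tensor p q = p \<bullet> (X *v q)"
  unfolding tensor_def inner_vec_def matrix_vector_mult_def
  by (simp add: sum_distrib_left mult_ac)

lemma inner_tensor_smallo: "(\<lambda>z. 1/2 * (X \<bullet> tensor z z)) \<in> o[at 0](norm)"
proof (rule landau_o.smallI)
  fix c :: real assume c: "c > 0"
  obtain K where K: "K > 0" "\<And>z. norm (X *v z) \<le> norm z * K"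
    using bounded_linear.pos_bounded[OF matrix_vector_mul_bounded_linear[of X]] by blast
  have "norm (1/2 * (X \<bullet> tensor z z)) \<le> c * norm (norm z)" if "norm z < c / K" for z
  proof -
    have "norm (1/2 * (X \<bullet> tensor z z)) \<le> \<bar>z \<bullet> (X *v z)\<bar>"
      by (simp add: inner_tensor)
    also have "\<dots> \<le> norm z * norm (X *v z)"
      by (rule Cauchy_Schwarz_ineq2)
    also have "\<dots> \<le> norm z * (norm z * K)"
      using K(2) by (intro mult_left_mono) auto
    also have "\<dots> \<le> norm z * c"
      using that K(1) by (intro mult_left_mono) (auto simp: field_simps)
    finally show ?thesis
      by (simp add: mult.commute)
  qed
  then show "\<forall>\<^sub>F z in at 0. norm (1/2 * (X \<bullet> tensor z z)) \<le> c * norm (norm z)"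
    using c K(1) by (auto simp: eventually_at dist_norm intro!: exI[of _ "c / K"])
qed

lemma smallo_square_imp_smallo_norm:
  fixes r :: "real^'n \<Rightarrow> real"
  assumes "r \<in> o[at 0](\<lambda>z. (norm z)\<^sup>2)"
  shows "r \<in> o[at 0](norm)"
proof (rule landau_o.small_big_trans[OF assms])
  have "norm ((norm z)\<^sup>2) \<le> 1 * norm (norm z)" if "norm z < 1" for z :: "real^'n"
    using mult_left_mono[of "norm z" 1 "norm z"] that by (simp add: power2_eq_square)
  then have "\<forall>\<^sub>F z::real^'n in at 0. norm ((norm z)\<^sup>2) \<le> 1 * norm (norm z)"
    by (auto simp: eventually_at dist_norm intro!: exI[of _ 1])
  then show "(\<lambda>z::real^'n. (norm z)\<^sup>2) \<in> O[at 0](norm)"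
    by (rule bigoI)
qed

text \<open>Along the ray through \<open>v\<close> itself the linear term grows like
  \<open>norm v * norm z\<close>, which no o(|z|) bound can dominate. A one-sided bound suffices
  because the direction is free.\<close>

lemma inner_le_smallo_imp_zero:
  fixes v :: "real^'n" and h :: "real^'n \<Rightarrow> real"
  assumes h: "h \<in> o[at 0](norm)"
    and le: "\<forall>\<^sub>F z in at 0. v \<bullet> z \<le> h z"
  shows "v = 0"
proof (rule ccontr)
  assume v: "v \<noteq> 0"
  have "\<forall>\<^sub>F z in at 0. norm (h z) \<le> norm v / 2 * norm (norm z)"
    using v by (intro landau_o.smallD[OF h]) simp
  with le have "\<forall>\<^sub>F z in at 0. v \<bullet> z \<le> norm v / 2 * norm z"
    by eventually_elim auto
  then obtain d where d: "d > 0" "\<And>z. z \<noteq> 0 \<Longrightarrow> norm z < d \<Longrightarrow> v \<bullet> z \<le> norm v / 2 * norm z"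
    by (auto simp: eventually_at dist_norm)
  \<comment> \<open>This choice puts \<open>t *\<^sub>R v\<close> at distance \<open>d / 2\<close>
    from the origin.\<close>
  define t where "t = d / (2 * norm v)"
  have t: "t > 0" "norm (t *\<^sub>R v) < d"
    using d(1) v by (auto simp: t_def)
  have "t * (norm v)\<^sup>2 \<le> t * (norm v)\<^sup>2 / 2"
    using d(2)[of "t *\<^sub>R v"] t v by (simp add: dot_square_norm power2_eq_square)
  then show False
    using t(1) v by simp
qed

text \<open>Subtracting the first-order expansion of \<open>u\<close> from the jet inequality leaves
  a linear functional bounded above by the quadratic term plus remainders, all of which are
  o(|z|).\<close>

lemma superjet_eq_grad:
  assumes u: "u differentiable (at x)" and jet: "(P, X) \<in> superjet u x"
  shows "P = grad u x"
proof -
  let ?e = "\<lambda>z. u (z + x) - u x - grad u x \<bullet> z"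
  obtain r where r: "r \<in> o[at 0](\<lambda>z. (norm z)\<^sup>2)"
    and le: "\<forall>\<^sub>F z in at 0. u (z + x) \<le> u x + P \<bullet> z + 1/2 * (X \<bullet> tensor z z) + r z"
    using jet unfolding superjet_def by auto
  have "(\<lambda>z. 1/2 * (X \<bullet> tensor z z) + r z - ?e z) \<in> o[at 0](norm)"
    by (intro sum_in_smallo inner_tensor_smallo smallo_square_imp_smallo_norm r
        GDERIV_remainder GDERIV_grad u)
  moreover have "\<forall>\<^sub>F z in at 0. (grad u x - P) \<bullet> z \<le> 1/2 * (X \<bullet> tensor z z) + r z - ?e z"
    using le by eventually_elim (simp add: inner_diff_left)
  ultimately have "grad u x - P = 0"
    by (rule inner_le_smallo_imp_zero)
  then show ?thesis
    by simp
qed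

lemma subjet_eq_grad:
  assumes u: "u differentiable (at x)" and jet: "(P, X) \<in> subjet u x"
  shows "P = grad u x"
proof -
  let ?e = "\<lambda>z. u (z + x) - u x - grad u x \<bullet> z"
  obtain r where r: "r \<in> o[at 0](\<lambda>z. (norm z)\<^sup>2)"
    and le: "\<forall>\<^sub>F z in at 0. u (z + x) \<ge> u x + P \<bullet> z + 1/2 * (X \<bullet> tensor z z) + r z"
    using jet unfolding subjet_def by auto
  have "(\<lambda>z. ?e z - 1/2 * (X \<bullet> tensor z z) - r z) \<in> o[at 0](norm)"
    by (intro sum_in_smallo inner_tensor_smallo smallo_square_imp_smallo_norm r
        GDERIV_remainder GDERIV_grad u)
  moreover have "\<forall>\<^sub>F z in at 0. (P - grad u x) \<bullet> z \<le> ?e z - 1/2 * (X \<bullet> tensor z z) - r z"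
    using le by eventually_elim (simp add: inner_diff_left)
  ultimately have "P - grad u x = 0"
    by (rule inner_le_smallo_imp_zero)
  then show ?thesis
    by simp
qed

section \<open>The essential supremum of a continuous field\<close>

text \<open>If the bound failed at \<open>x\<close>, it would fail on a relatively open
  neighbourhood of \<open>x\<close> in the closure. That neighbourhood meets \<open>S\<close> in a
  nonempty open set, which cannot be null. Boundary points are covered, and this is what lets
  \<open>max_points\<close> be used there.\<close>

lemma norm_le_Linf_norm:
  fixes F :: "real^'n \<Rightarrow> real^'n"
  assumes S: "open S" and F: "continuous_on (closure S) F" and x: "x \<in> closure S"
  shows "ennreal (norm (F x)) \<le> Linf_norm S F"
proof (rule ccontr)
  define g where "g = (\<lambda>y. ennreal (norm (F y)))"
  assume "\<not> ?thesis"
  then have gx: "Linf_norm S F < g x"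
    by (simp add: g_def)
  have "continuous_on (closure S) g"
    unfolding g_def by (intro continuous_on_ennreal continuous_on_norm F)
  then obtain T where T: "open T" "T \<inter> closure S = g -` {Linf_norm S F<..} \<inter> closure S"
    using continuous_on_open_invariant open_greaterThan by metis
  have "x \<in> T"
    using T(2) x gx by auto
  then have ne: "T \<inter> S \<noteq> {}"
    using x T(1) open_Int_closure_eq_empty by blast
  have "AE y in lebesgue_on S. g y \<le> Linf_norm S F"
    unfolding Linf_norm_def g_def by (rule esssup_AE)
  then have "AE y in lebesgue. y \<in> S \<longrightarrow> g y \<le> Linf_norm S F"
    using S by (subst (asm) AE_restrict_space_iff) auto
  then have "AE y in lebesgue. y \<notin> T \<inter> S"
    by eventually_elim (use T(2) closure_subset[of S] in force)
  then obtain N where "negligible N" "{y. \<not> y \<notin> T \<inter> S} \<subseteq> N"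
    unfolding eventually_ae_filter_negligible by blast
  then have "negligible (T \<inter> S)"
    by (elim negligible_subset) auto
  then show False
    using open_not_negligible[of "T \<inter> S"] S T(1) ne by blast
qed

lemma Linf_norm_le:
  fixes F :: "real^'n \<Rightarrow> real^'n"
  assumes S: "open S" and F: "continuous_on S F" and le: "\<And>y. y \<in> S \<Longrightarrow> norm (F y) \<le> c"
  shows "Linf_norm S F \<le> ennreal c"
  unfolding Linf_norm_def
proof (rule esssup_I)
  \<comment> \<open>\<open>esssup\<close> takes the default value \<open>top\<close> on
    non-measurable functions, so an upper bound has to begin with measurability.\<close>
  have "F \<in> borel_measurable (lebesgue_on S)"
    using F S by (intro continuous_imp_measurable_on_sets_lebesgue) auto
  then show "(\<lambda>x. ennreal (norm (F x))) \<in> borel_measurable (lebesgue_on S)"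
    by measurable
  show "AE x in lebesgue_on S. ennreal (norm (F x)) \<le> ennreal c"
    by (rule AE_I2) (use le in \<open>auto simp: ennreal_leI\<close>)
qed

section \<open>Affine perturbations of the gradient\<close>

lemma norm_le_norm_add:
  fixes p q :: "'a::real_inner"
  assumes "p \<bullet> q \<ge> 0"
  shows "norm p \<le> norm (p + q)"
proof (rule power2_le_imp_le)
  show "(norm p)\<^sup>2 \<le> (norm (p + q))\<^sup>2"
    using assms by (simp add: power2_norm_eq_inner inner_add inner_commute)
qed simp

lemma inner_nonneg_if_norm_minimal:
  fixes p q :: "'a::real_inner"
  assumes min: "\<And>t. t \<ge> 0 \<Longrightarrow> norm p \<le> norm (p + t *\<^sub>R q)"
  shows "p \<bullet> q \<ge> 0"
proof (rule ccontr)
  assume neg: "\<not> p \<bullet> q \<ge> 0"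
  then have q: "q \<bullet> q > 0"
    by auto
  \<comment> \<open>The vertex of the parabola
    \<open>t \<mapsto> (norm (p + t *\<^sub>R q))\<^sup>2\<close>; it is positive when
    \<open>p \<bullet> q\<close> is negative, and the value there lies strictly below the one at
    0.\<close>
  define t where "t = - (p \<bullet> q) / (q \<bullet> q)"
  have t: "t \<ge> 0" "t * (q \<bullet> q) = - (p \<bullet> q)"
    using neg q by (auto simp: t_def divide_simps)
  have "p \<bullet> p \<le> (p + t *\<^sub>R q) \<bullet> (p + t *\<^sub>R q)"
    using min[OF t(1)] by (simp add: norm_le)
  also have "\<dots> = p \<bullet> p + 2 * t * (p \<bullet> q) + t * (t * (q \<bullet> q))"
    by (simp add: inner_add inner_commute)
  also have "\<dots> = p \<bullet> p + t * (p \<bullet> q)"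
    unfolding t(2) by simp
  finally have "0 \<le> t * (p \<bullet> q)"
    by simp
  moreover have "t > 0"
    using neg q by (auto simp: t_def divide_simps)
  ultimately show False
    using neg by (simp add: zero_le_mult_iff)
qed

text \<open>Only the value of the perturbed field at \<open>x\<close> matters: there the norm does
  not decrease, and the essential supremum dominates it even if \<open>x\<close> lies on the
  boundary of \<open>S\<close>.\<close>

lemma Linf_norm_le_add:
  fixes u :: "real^'n \<Rightarrow> real"
  assumes u: "C1_on \<Omega> u" and S: "open S" "S \<Subset> \<Omega>" and x: "x \<in> max_points S u"
    and pos: "grad u x \<bullet> q \<ge> 0"
  shows "Linf_norm S (grad u) \<le> Linf_norm S (\<lambda>y. grad u y + q)"
proof -
  have "continuous_on (closure S) (grad u)"
    using u S(2) continuous_on_subset unfolding C1_on_def compactly_contained_def by blast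
  then have "continuous_on (closure S) (\<lambda>y. grad u y + q)"
    by (intro continuous_intros)
  moreover have "x \<in> closure S" and eq: "Linf_norm S (grad u) = ennreal (norm (grad u x))"
    using x by (auto simp: max_points_def)
  ultimately have "ennreal (norm (grad u x + q)) \<le> Linf_norm S (\<lambda>y. grad u y + q)"
    using norm_le_Linf_norm[OF S(1)] by blast
  moreover have "ennreal (norm (grad u x)) \<le> ennreal (norm (grad u x + q))"
    using norm_le_norm_add[OF pos] by (rule ennreal_leI)
  ultimately show ?thesis
    unfolding eq by (rule order_trans[rotated])
qed

text \<open>A strict sublevel set of |Du| near \<open>x\<close> works: it omits \<open>x\<close> but
  accumulates there, so by continuity its essential supremum is exactly |Du(x)|.\<close>

lemma ex_max_points_near:
  fixes u :: "real^'n \<Rightarrow> real"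
  assumes \<Omega>: "open \<Omega>" and u: "C1_on \<Omega> u" and x: "x \<in> \<Omega>"
    and nomin: "\<not> local_min_on (\<lambda>y. norm (grad u y)) \<Omega> x" and e: "e > 0"
  obtains S where "open S" "S \<noteq> {}" "S \<Subset> \<Omega>" "x \<in> max_points S u"
    "\<And>y. y \<in> S \<Longrightarrow> dist (grad u y) (grad u x) < e"
proof -
  have cont: "continuous_on \<Omega> (grad u)"
    using u by (simp add: C1_on_def)
  then obtain d where d: "d > 0" "\<And>y. y \<in> \<Omega> \<Longrightarrow> dist y x < d \<Longrightarrow> dist (grad u y) (grad u x) < e"
    using x e unfolding continuous_on_iff by blast
  obtain r where r: "r > 0" "cball x r \<subseteq> \<Omega>"
    using \<Omega> x open_contains_cball by blast
  \<comment> \<open>The bound \<open>d\<close> controls the oscillation of the gradient; the bound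
    \<open>r\<close> keeps even the closed ball, hence the closure of \<open>S\<close>, inside
    \<Omega>.\<close>
  define R where "R = min d r"
  define S where "S = {y \<in> ball x R. norm (grad u y) < norm (grad u x)}"
  have R: "R > 0" "ball x R \<subseteq> \<Omega>" "cball x R \<subseteq> \<Omega>" "R \<le> d"
    using d(1) r by (auto simp: R_def subset_iff)
  have S_sub: "S \<subseteq> \<Omega>"
    using R(2) by (auto simp: S_def)
  have "continuous_on (ball x R) (\<lambda>y. norm (grad u y))"
    by (intro continuous_on_norm continuous_on_subset[OF cont R(2)])
  then have "open (ball x R \<inter> (\<lambda>y. norm (grad u y)) -` {..<norm (grad u x)})"
    by (intro continuous_open_preimage) auto
  moreover have "S = ball x R \<inter> (\<lambda>y. norm (grad u y)) -` {..<norm (grad u x)}"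
    by (auto simp: S_def)
  ultimately have "open S"
    by simp
  have "\<exists>y\<in>S. dist y x < k" if "k > 0" for k
  proof -
    \<comment> \<open>Failure of the local minimum at scale \<open>min k R\<close> yields a point
      that is both close to \<open>x\<close> and in the ball defining \<open>S\<close>.\<close>
    have "\<exists>y\<in>\<Omega>. y \<noteq> x \<and> dist y x < min k R \<and> norm (grad u y) < norm (grad u x)"
      using nomin x that R(1) unfolding local_min_on_def eventually_at
      by (auto simp: not_le dest!: spec[of _ "min k R"])
    then show ?thesis
      by (auto simp: S_def dist_commute)
  qed
  then have x_cl: "x \<in> closure S"
    by (simp add: closure_approachable)
  then have "S \<noteq> {}"
    by auto
  have "closure S \<subseteq> cball x R"
    by (rule closure_minimal) (auto simp: S_def)
  then have "closure S \<subseteq> \<Omega>"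
    using R(3) by blast
  moreover have "compact (closure S)"
    using \<open>closure S \<subseteq> cball x R\<close> bounded_cball bounded_subset compact_eq_bounded_closed by blast
  ultimately have "S \<Subset> \<Omega>"
    by (simp add: compactly_contained_def)
  have "Linf_norm S (grad u) \<le> ennreal (norm (grad u x))"
    using \<open>open S\<close> continuous_on_subset[OF cont S_sub] by (rule Linf_norm_le) (simp add: S_def)
  moreover have "ennreal (norm (grad u x)) \<le> Linf_norm S (grad u)"
    using \<open>open S\<close> continuous_on_subset[OF cont \<open>closure S \<subseteq> \<Omega>\<close>] x_cl by (rule norm_le_Linf_norm)
  ultimately have "x \<in> max_points S u"
    using x_cl by (simp add: max_points_def)
  moreover have "dist (grad u y) (grad u x) < e" if "y \<in> S" for y
    using d(2)[of y] that S_sub R(4) by (auto simp: S_def dist_commute)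
  ultimately show thesis
    using that \<open>open S\<close> \<open>S \<noteq> {}\<close> \<open>S \<Subset> \<Omega>\<close> by blast
qed

text \<open>With \<open>t\<close> fixed and the gradient within \<open>e\<close> of its value at
  \<open>x\<close> on all of \<open>S\<close>, the supremum norm of the perturbed field is at most
  \<open>norm (grad u x + t *\<^sub>R q) + e\<close>. Since \<open>S\<close> may depend on
  \<open>e\<close>, letting \<open>e\<close> tend to 0 gives the pointwise minimality.\<close>

lemma inner_nonneg_if_Linf_minimal:
  fixes u :: "real^'n \<Rightarrow> real"
  assumes \<Omega>: "open \<Omega>" and u: "C1_on \<Omega> u" and x: "x \<in> \<Omega>"
    and nomin: "\<not> local_min_on (\<lambda>y. norm (grad u y)) \<Omega> x"
    and min: "\<And>S t. open S \<Longrightarrow> S \<noteq> {} \<Longrightarrow> S \<Subset> \<Omega> \<Longrightarrow> x \<in> max_points S u \<Longrightarrow> t \<ge> 0 \<Longrightarrow>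
      Linf_norm S (grad u) \<le> Linf_norm S (\<lambda>y. grad u y + t *\<^sub>R q)"
  shows "grad u x \<bullet> q \<ge> 0"
proof (rule inner_nonneg_if_norm_minimal)
  fix t :: real assume t: "t \<ge> 0"
  show "norm (grad u x) \<le> norm (grad u x + t *\<^sub>R q)"
  proof (rule field_le_epsilon)
    fix e :: real assume e: "e > 0"
    obtain S where S: "open S" "S \<noteq> {}" "S \<Subset> \<Omega>" "x \<in> max_points S u"
      and near: "\<And>y. y \<in> S \<Longrightarrow> dist (grad u y) (grad u x) < e"
      using ex_max_points_near[OF \<Omega> u x nomin e] by metis
    have "S \<subseteq> \<Omega>"
      using S(3) closure_subset by (auto simp: compactly_contained_def)
    then have "continuous_on S (grad u)"
      using u continuous_on_subset by (auto simp: C1_on_def)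
    then have cont: "continuous_on S (\<lambda>y. grad u y + t *\<^sub>R q)"
      by (intro continuous_intros)
    have "norm (grad u y + t *\<^sub>R q) \<le> norm (grad u x + t *\<^sub>R q) + e" if "y \<in> S" for y
      using norm_triangle_ineq[of "grad u x + t *\<^sub>R q" "grad u y - grad u x"] near[OF that]
      by (simp add: dist_norm algebra_simps)
    then have "Linf_norm S (\<lambda>y. grad u y + t *\<^sub>R q) \<le> ennreal (norm (grad u x + t *\<^sub>R q) + e)"
      by (rule Linf_norm_le[OF S(1) cont])
    with min[OF S t] have "Linf_norm S (grad u) \<le> ennreal (norm (grad u x + t *\<^sub>R q) + e)"
      by (rule order_trans)
    moreover have "Linf_norm S (grad u) = ennreal (norm (grad u x))"
      using S(4) by (simp add: max_points_def)
    ultimately have "ennreal (norm (grad u x)) \<le> ennreal (norm (grad u x + t *\<^sub>R q) + e)"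
      by (simp only:)
    then show "norm (grad u x) \<le> norm (grad u x + t *\<^sub>R q) + e"
      using e by (subst (asm) ennreal_le_iff) auto
  qed
qed

section \<open>Viscosity inequalities as minimality under affine perturbations\<close>

lemma viscosity_ge0_iff:
  fixes u :: "real^'n \<Rightarrow> real"
  assumes \<Omega>: "open \<Omega>" and u: "C1_on \<Omega> u"
    and nomin: "\<not> (\<exists>x. local_min_on (\<lambda>y. norm (grad u y)) \<Omega> x)"
  shows "viscosity_ge0 \<Omega> u \<longleftrightarrow>
    (\<forall>S. open S \<and> S \<noteq> {} \<and> S \<Subset> \<Omega> \<longrightarrow>
      (\<forall>A\<in>affine_plus S u. Linf_norm S (grad u) \<le> Linf_norm S (\<lambda>x. grad u x + grad A x)))"
    (is "_ \<longleftrightarrow> ?min")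
proof
  assume visc: "viscosity_ge0 \<Omega> u"
  show ?min
  proof (intro allI impI ballI)
    fix S A assume S: "open S \<and> S \<noteq> {} \<and> S \<Subset> \<Omega>" and "A \<in> affine_plus S u"
    then consider c where "A = (\<lambda>y. c)"
      | \<xi> x X where "\<xi> \<ge> 0" "x \<in> max_points S u" "X \<in> D2_plus u x"
          "\<And>y. grad A y = \<xi> *\<^sub>R (X *v grad u x)"
      unfolding affine_plus_def by blast
    then show "Linf_norm S (grad u) \<le> Linf_norm S (\<lambda>x. grad u x + grad A x)"
    proof cases
      case 1
      then show ?thesis by (simp add: grad_const)
    next
      case 2
      have "x \<in> \<Omega>"
        using S 2(2) by (auto simp: compactly_contained_def max_points_def)
      then have "tensor (grad u x) (grad u x) \<bullet> X \<ge> 0"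
        using visc 2(3) by (auto simp: viscosity_ge0_def D2_plus_def superjet0_def)
      then have "grad u x \<bullet> (\<xi> *\<^sub>R (X *v grad u x)) \<ge> 0"
        using 2(1) by (simp add: inner_commute[of _ X] inner_tensor)
      then show ?thesis
        unfolding 2(4) using Linf_norm_le_add[OF u _ _ 2(2)] S by blast
    qed
  qed
next
  assume min: ?min
  have "tensor P P \<bullet> X \<ge> 0" if x: "x \<in> \<Omega>" and jet: "(P, X) \<in> superjet u x" for x P X
  \<comment> \<open>\<open>D2_plus\<close> sees only jets with nonzero first component; for
    \<open>P = 0\<close> the contraction vanishes anyway.\<close>
  proof (cases "P = 0")
    case False
    have P: "P = grad u x"
      using superjet_eq_grad[OF _ jet] u x by (auto simp: C1_on_def)
    have X: "X \<in> D2_plus u x"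
      using jet False P by (simp add: D2_plus_def superjet0_def)
    have "grad u x \<bullet> (X *v grad u x) \<ge> 0"
    proof (rule inner_nonneg_if_Linf_minimal[OF \<Omega> u x])
      fix S and t :: real
      assume S: "open S" "S \<noteq> {}" "S \<Subset> \<Omega>" "x \<in> max_points S u" and t: "t \<ge> 0"
      \<comment> \<open>The jet \<open>X\<close> at \<open>x\<close> is chosen before
        \<open>S\<close>, so the same \<open>A\<close> is admissible for every \<open>S\<close> that
        has \<open>x\<close> among its \<open>max_points\<close>.\<close>
      define A where "A = (\<lambda>y. (t *\<^sub>R (X *v grad u x)) \<bullet> y + 0)"
      have A: "grad A y = t *\<^sub>R (X *v grad u x)" for y
        unfolding A_def by (rule grad_affine)
      then have "A \<in> affine_plus S u"
        using t S(4) X unfolding affine_plus_def affine_fun_def A_def by blast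
      then show "Linf_norm S (grad u) \<le> Linf_norm S (\<lambda>y. grad u y + t *\<^sub>R (X *v grad u x))"
        using min S A by force
    qed (use nomin in blast)
    then show ?thesis
      by (simp add: P inner_commute[of _ X] inner_tensor)
  qed (simp add: inner_commute[of _ X] inner_tensor)
  then show "viscosity_ge0 \<Omega> u"
    by (auto simp: viscosity_ge0_def)
qed

text \<open>Passing to subjets flips the sign of \<open>P \<bullet> (X *v P)\<close> together with
  that of \<xi>, so their product is again nonnegative and the same two lemmas on perturbations
  apply.\<close>

lemma viscosity_le0_iff:
  fixes u :: "real^'n \<Rightarrow> real"
  assumes \<Omega>: "open \<Omega>" and u: "C1_on \<Omega> u"
    and nomin: "\<not> (\<exists>x. local_min_on (\<lambda>y. norm (grad u y)) \<Omega> x)"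
  shows "viscosity_le0 \<Omega> u \<longleftrightarrow>
    (\<forall>S. open S \<and> S \<noteq> {} \<and> S \<Subset> \<Omega> \<longrightarrow>
      (\<forall>A\<in>affine_minus S u. Linf_norm S (grad u) \<le> Linf_norm S (\<lambda>x. grad u x + grad A x)))"
    (is "_ \<longleftrightarrow> ?min")
proof
  assume visc: "viscosity_le0 \<Omega> u"
  show ?min
  proof (intro allI impI ballI)
    fix S A assume S: "open S \<and> S \<noteq> {} \<and> S \<Subset> \<Omega>" and "A \<in> affine_minus S u"
    then consider c where "A = (\<lambda>y. c)"
      | \<xi> x X where "\<xi> \<le> 0" "x \<in> max_points S u" "X \<in> D2_minus u x"
          "\<And>y. grad A y = \<xi> *\<^sub>R (X *v grad u x)"
      unfolding affine_minus_def by blast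
    then show "Linf_norm S (grad u) \<le> Linf_norm S (\<lambda>x. grad u x + grad A x)"
    proof cases
      case 1
      then show ?thesis by (simp add: grad_const)
    next
      case 2
      have "x \<in> \<Omega>"
        using S 2(2) by (auto simp: compactly_contained_def max_points_def)
      then have "tensor (grad u x) (grad u x) \<bullet> X \<le> 0"
        using visc 2(3) by (auto simp: viscosity_le0_def D2_minus_def subjet0_def)
      then have "grad u x \<bullet> (\<xi> *\<^sub>R (X *v grad u x)) \<ge> 0"
        using 2(1) by (simp add: inner_commute[of _ X] inner_tensor mult_nonpos_nonpos)
      then show ?thesis
        unfolding 2(4) using Linf_norm_le_add[OF u _ _ 2(2)] S by blast
    qed
  qed
next
  assume min: ?min
  have "tensor P P \<bullet> X \<le> 0" if x: "x \<in> \<Omega>" and jet: "(P, X) \<in> subjet u x" for x P X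
  proof (cases "P = 0")
    case False
    have P: "P = grad u x"
      using subjet_eq_grad[OF _ jet] u x by (auto simp: C1_on_def)
    have X: "X \<in> D2_minus u x"
      using jet False P by (simp add: D2_minus_def subjet0_def)
    \<comment> \<open>The minus sign is moved into the direction, so that the parameter
      \<open>t \<ge> 0\<close> of the perturbation corresponds to the admissible coefficient
      \<open>- t \<le> 0\<close>.\<close>
    have "grad u x \<bullet> - (X *v grad u x) \<ge> 0"
    proof (rule inner_nonneg_if_Linf_minimal[OF \<Omega> u x])
      fix S and t :: real
      assume S: "open S" "S \<noteq> {}" "S \<Subset> \<Omega>" "x \<in> max_points S u" and t: "t \<ge> 0"
      define A where "A = (\<lambda>y. ((- t) *\<^sub>R (X *v grad u x)) \<bullet> y + 0)"
      have A: "grad A y = (- t) *\<^sub>R (X *v grad u x)" for y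
        unfolding A_def by (rule grad_affine)
      moreover have "- t \<le> 0"
        using t by simp
      ultimately have "A \<in> affine_minus S u"
        using S(4) X unfolding affine_minus_def affine_fun_def A_def by blast
      then have "Linf_norm S (grad u) \<le> Linf_norm S (\<lambda>y. grad u y + grad A y)"
        using min S by blast
      then show "Linf_norm S (grad u) \<le> Linf_norm S (\<lambda>y. grad u y + t *\<^sub>R - (X *v grad u x))"
        by (simp add: A)
    qed (use nomin in blast)
    then show ?thesis
      by (simp add: P inner_commute[of _ X] inner_tensor)
  qed (simp add: inner_commute[of _ X] inner_tensor)
  then show "viscosity_le0 \<Omega> u"
    by (auto simp: viscosity_le0_def)
qed

theorem theorem9:
  fixes \<Omega> :: "(real^'n) set" and u :: "real^'n \<Rightarrow> real"
  assumes "open \<Omega>"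
    and "C1_on \<Omega> u"
    and "\<not> (\<exists>x. local_min_on (\<lambda>y. norm (grad u y)) \<Omega> x)"
  shows "(viscosity_ge0 \<Omega> u \<longleftrightarrow>
           (\<forall>\<Omega>'. open \<Omega>' \<and> \<Omega>' \<noteq> {} \<and> \<Omega>' \<Subset> \<Omega> \<longrightarrow>
             (\<forall>A\<in>affine_plus \<Omega>' u.
               Linf_norm \<Omega>' (grad u) \<le> Linf_norm \<Omega>' (\<lambda>x. grad u x + grad A x)))) \<and>
         (viscosity_le0 \<Omega> u \<longleftrightarrow>
           (\<forall>\<Omega>'. open \<Omega>' \<and> \<Omega>' \<noteq> {} \<and> \<Omega>' \<Subset> \<Omega> \<longrightarrow>
             (\<forall>A\<in>affine_minus \<Omega>' u.
               Linf_norm \<Omega>' (grad u) \<le> Linf_norm \<Omega>' (\<lambda>x. grad u x + grad A x))))"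
  using viscosity_ge0_iff[OF assms] viscosity_le0_iff[OF assms] by blast

end
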